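(* Let $0\le s\le r\le\omega$ and let $k,\ell\ge 0$ be integers. The space $(\mathcal S^{r,s}_{k,\ell},\subset)$ of $k$-solenoids of class $C^{r,s}$ and transversal dimension $\ell$, ordered by inclusion, is an inductive set.
   Context: Each of $r,s$ is a non-negative integer, $\infty$ or $\omega$ ($C^\omega$ = analytic), $s\le r$. A map $X(x,y)$ on an open subset of $\mathbb R^k\times\mathbb R^\ell$ is of class $C^{r,s}$ if it is $C^r$ in the leaf variable $x$ and $C^s$ in the transversal variable $y$: the partial derivatives $\partial_x^\alpha\partial_y^\beta X$ with $|\beta|\le s$, $|\alpha|+|\beta|\le r$ exist and are continuous (with the usual interpretation for $\infty,\omega$). A foliated manifold $W$ (dimension $k+\ell$, $k$-dimensional leaves, class $C^{r,s}$) is a manifold of dimension $k+\ell$ with an atlas of charts $\varphi_i:U_i\to\mathbb R^k\times\mathbb R^\ell$ whose transition maps have the form $(x,y)\mapsto (X_{ij}(x,y),Y_{ij}(y))$ with $Y_{ij}$ of class $C^s$ and $X_{ij}$ of class $C^{r,s}$; its leaves are the leaves of the corresponding foliation. A regular map between foliated manifolds is a continuous map locally of the form $(X(x,y),Y(y))$ in such charts with $X$ of class $C^{r,s}$, $Y$ of class $C^s$; a diffeomorphism is a homeomorphism regular in both directions. A pre-solenoid $(S,W)$ consists of a foliated manifold $W$ and a non-empty compact subspace $S\subset W$ which is a union of leaves of $W$. Two pre-solenoids $(S,W_1),(S,W_2)$ are equivalent if there are open sets $U_i\subset W_i$ containing $S$ and a diffeomorphism $U_1\to U_2$ which is the identity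 on $S$. A $k$-solenoid of class $C^{r,s}$ and transversal dimension $\ell$ is an equivalence class of pre-solenoids; it is denoted $S$, and $W$ is said to define its solenoid structure. A leaf of $S$ is a leaf of $W$ contained in $S$. The order: $S\subset S'$ means that $S$ is a subset of $S'$ which is a union of leaves of $S'$, with the solenoid structure given by a foliated manifold defining that of $S'$. Inductive (for the decreasing direction) means: every non-empty totally ordered family of elements has a lower bound in $\mathcal S^{r,s}_{k,\ell}$. *)

theory Defs
  imports "HOL-Analysis.Analysis" "HOL-Library.Extended_Nat"
begin

section \<open>Regularity classes\<close>

text \<open>
  Regularities are ordered \<open>0 < 1 < 2 < \<dots> < \<infinity> < \<omega>\<close>: \<open>Ck n\<close> with \<open>n :: enat\<close> stands for a
  non-negative integer or \<open>\<infinity>\<close>, and \<open>C_omega\<close> for \<open>\<omega>\<close>.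
\<close>

datatype regularity = Ck enat | C_omega

instantiation regularity :: linorder
begin

fun less_eq_regularity :: "regularity \<Rightarrow> regularity \<Rightarrow> bool" where
  "less_eq_regularity (Ck m) (Ck n) = (m \<le> n)"
| "less_eq_regularity _ C_omega = True"
| "less_eq_regularity C_omega (Ck _) = False"

definition less_regularity :: "regularity \<Rightarrow> regularity \<Rightarrow> bool" where
  "less_regularity r s \<longleftrightarrow> r \<le> s \<and> \<not> s \<le> r"

instance
proof
  fix x y z :: regularity
  show "(x < y) = (x \<le> y \<and> \<not> y \<le> x)" by (simp add: less_regularity_def)
  show "x \<le> x" by (cases x) auto
  show "x \<le> y \<Longrightarrow> y \<le> z \<Longrightarrow> x \<le> z" by (cases x; cases y; cases z) auto
  show "x \<le> y \<Longrightarrow> y \<le> x \<Longrightarrow> x = y" by (cases x; cases y) auto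
  show "x \<le> y \<or> y \<le> x" by (cases x; cases y) auto
qed

end

text \<open>The bound imposed on the number of derivatives; analytic maps are in particular \<open>C\<^sup>\<infinity>\<close>.\<close>

fun deriv_bound :: "regularity \<Rightarrow> enat" where
  "deriv_bound (Ck n) = n"
| "deriv_bound C_omega = \<infinity>"


section \<open>Partial derivatives and analyticity on \<open>\<real>\<^sup>n\<close>\<close>

text \<open>
  As in \<^const>\<open>Euclidean_space\<close>, a point of \<open>\<real>\<^sup>n\<close> is a function \<open>nat \<Rightarrow> real\<close> vanishing at all
  indices \<open>\<ge> n\<close>; this allows \<open>n = 0\<close>.  A partial derivative \<open>\<partial>\<^sup>\<alpha>\<close> is given by the word
  \<open>[i\<^sub>1, \<dots>, i\<^sub>m]\<close> of the coordinates in which one differentiates (\<open>i\<^sub>m\<close> first).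
\<close>

definition partial :: "nat \<Rightarrow> ((nat \<Rightarrow> real) \<Rightarrow> real) \<Rightarrow> (nat \<Rightarrow> real) \<Rightarrow> real" where
  "partial i f a = deriv (\<lambda>t. f (a(i := t))) (a i)"

fun iter_partial :: "nat list \<Rightarrow> ((nat \<Rightarrow> real) \<Rightarrow> real) \<Rightarrow> (nat \<Rightarrow> real) \<Rightarrow> real" where
  "iter_partial [] f = f"
| "iter_partial (i # w) f = partial i (iter_partial w f)"

fun has_iter_partial :: "nat list \<Rightarrow> ((nat \<Rightarrow> real) \<Rightarrow> real) \<Rightarrow> (nat \<Rightarrow> real) set \<Rightarrow> bool" where
  "has_iter_partial [] f V \<longleftrightarrow> True"
| "has_iter_partial (i # w) f V \<longleftrightarrow> has_iter_partial w f V \<and>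
     (\<forall>a\<in>V. (\<lambda>t. iter_partial w f (a(i := t))) differentiable at (a i))"

definition real_analytic_at :: "nat \<Rightarrow> ((nat \<Rightarrow> real) \<Rightarrow> real) \<Rightarrow> (nat \<Rightarrow> real) \<Rightarrow> bool" where
  "real_analytic_at n f a \<longleftrightarrow>
     (\<exists>e>0. \<exists>c. \<forall>x \<in> topspace (Euclidean_space n). (\<forall>i<n. \<bar>x i - a i\<bar> < e) \<longrightarrow>
        ((\<lambda>\<alpha>. c \<alpha> * (\<Prod>i<n. (x i - a i) ^ \<alpha> i)) has_sum f x) (PiE {..<n} (\<lambda>_. UNIV)))"

text \<open>Scalar functions of class \<open>C\<^sup>s\<close> on an open set \<open>V \<subseteq> \<real>\<^sup>n\<close>.\<close>

definition class_C :: "nat \<Rightarrow> regularity \<Rightarrow> (nat \<Rightarrow> real) set \<Rightarrow> ((nat \<Rightarrow> real) \<Rightarrow> real) \<Rightarrow> bool" where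
  "class_C n s V f \<longleftrightarrow>
     (\<forall>w. set w \<subseteq> {..<n} \<and> enat (length w) \<le> deriv_bound s \<longrightarrow>
        has_iter_partial w f V \<and>
        continuous_map (subtopology (Euclidean_space n) V) euclideanreal (iter_partial w f)) \<and>
     (s = C_omega \<longrightarrow> (\<forall>a\<in>V. real_analytic_at n f a))"


section \<open>Functions of class \<open>C\<^sup>r\<^sup>,\<^sup>s\<close> on \<open>\<real>\<^sup>k \<times> \<real>\<^sup>l\<close>\<close>

type_synonym point = "(nat \<Rightarrow> real) \<times> (nat \<Rightarrow> real)"

abbreviation product_space :: "nat \<Rightarrow> nat \<Rightarrow> point topology" where
  "product_space k l \<equiv> prod_topology (Euclidean_space k) (Euclidean_space l)"

text \<open>\<open>mixed_partial \<alpha> \<beta> u\<close> is \<open>\<partial>\<^sub>x\<^sup>\<alpha> \<partial>\<^sub>y\<^sup>\<beta> u\<close>.\<close>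

definition mixed_partial :: "nat list \<Rightarrow> nat list \<Rightarrow> (point \<Rightarrow> real) \<Rightarrow> point \<Rightarrow> real" where
  "mixed_partial \<alpha> \<beta> u =
     (\<lambda>(x, y). iter_partial \<alpha> (\<lambda>x'. iter_partial \<beta> (\<lambda>y'. u (x', y')) y) x)"

definition has_mixed_partial :: "nat list \<Rightarrow> nat list \<Rightarrow> (point \<Rightarrow> real) \<Rightarrow> point set \<Rightarrow> bool" where
  "has_mixed_partial \<alpha> \<beta> u D \<longleftrightarrow>
     (\<forall>x. has_iter_partial \<beta> (\<lambda>y'. u (x, y')) {y. (x, y) \<in> D}) \<and>
     (\<forall>y. has_iter_partial \<alpha> (\<lambda>x'. mixed_partial [] \<beta> u (x', y)) {x. (x, y) \<in> D})"

definition jointly_analytic_at :: "nat \<Rightarrow> nat \<Rightarrow> (point \<Rightarrow> real) \<Rightarrow> point \<Rightarrow> bool" where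
  "jointly_analytic_at k l u = (\<lambda>(a, b).
     \<exists>e>0. \<exists>c. \<forall>(x, y) \<in> topspace (product_space k l).
        (\<forall>i<k. \<bar>x i - a i\<bar> < e) \<and> (\<forall>j<l. \<bar>y j - b j\<bar> < e) \<longrightarrow>
        ((\<lambda>(\<alpha>, \<beta>). c \<alpha> \<beta> * (\<Prod>i<k. (x i - a i) ^ \<alpha> i) * (\<Prod>j<l. (y j - b j) ^ \<beta> j))
           has_sum u (x, y)) (PiE {..<k} (\<lambda>_. UNIV) \<times> PiE {..<l} (\<lambda>_. UNIV)))"

text \<open>
  Convention for \<open>\<omega>\<close> (where \<open>s \<le> r\<close>): a function of class \<open>C\<^sup>\<omega>\<^sup>,\<^sup>\<omega>\<close> is analytic in \<open>(x, y)\<close> jointly;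
  for \<open>s < \<omega>\<close>, a function of class \<open>C\<^sup>\<omega>\<^sup>,\<^sup>s\<close> is of class \<open>C\<^sup>\<infinity>\<^sup>,\<^sup>s\<close> and the derivatives \<open>\<partial>\<^sub>y\<^sup>\<beta> u\<close> with
  \<open>|\<beta>| \<le> s\<close> are analytic in \<open>x\<close> for each fixed \<open>y\<close>.
\<close>

definition class_C2 ::
    "nat \<Rightarrow> nat \<Rightarrow> regularity \<Rightarrow> regularity \<Rightarrow> point set \<Rightarrow> (point \<Rightarrow> real) \<Rightarrow> bool" where
  "class_C2 k l r s D u \<longleftrightarrow>
     (\<forall>\<alpha> \<beta>. set \<alpha> \<subseteq> {..<k} \<and> set \<beta> \<subseteq> {..<l} \<and>
        enat (length \<beta>) \<le> deriv_bound s \<and> enat (length \<alpha> + length \<beta>) \<le> deriv_bound r \<longrightarrow>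
        has_mixed_partial \<alpha> \<beta> u D \<and>
        continuous_map (subtopology (product_space k l) D) euclideanreal (mixed_partial \<alpha> \<beta> u)) \<and>
     (r = C_omega \<longrightarrow>
        (\<forall>\<beta>. set \<beta> \<subseteq> {..<l} \<and> enat (length \<beta>) \<le> deriv_bound s \<longrightarrow>
           (\<forall>(a, b)\<in>D. real_analytic_at k (\<lambda>x. mixed_partial [] \<beta> u (x, b)) a))) \<and>
     (s = C_omega \<longrightarrow> (\<forall>p\<in>D. jointly_analytic_at k l u p))"

text \<open>Maps of the form \<open>(x, y) \<mapsto> (X (x, y), Y y)\<close> with \<open>X\<close> of class \<open>C\<^sup>r\<^sup>,\<^sup>s\<close> and \<open>Y\<close> of class \<open>C\<^sup>s\<close>.\<close>

definition foliated_form ::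
    "nat \<Rightarrow> nat \<Rightarrow> regularity \<Rightarrow> regularity \<Rightarrow> point set \<Rightarrow> (point \<Rightarrow> point) \<Rightarrow> bool" where
  "foliated_form k l r s D h \<longleftrightarrow>
     (\<exists>X Y. (\<forall>(x, y)\<in>D. h (x, y) = (X (x, y), Y y)) \<and>
        (\<forall>i<k. class_C2 k l r s D (\<lambda>p. X p i)) \<and>
        (\<forall>j<l. class_C l s (snd ` D) (\<lambda>y. Y y j)))"


section \<open>Foliated manifolds\<close>

text \<open>A chart is a pair \<open>(U, \<phi>)\<close>; only the values of \<open>\<phi>\<close> on its domain \<open>U\<close> matter.\<close>

type_synonym 'a chart = "'a set \<times> ('a \<Rightarrow> point)"

record 'a foliated =
  top_of :: "'a topology"
  atlas :: "'a chart set"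

definition chart_on :: "nat \<Rightarrow> nat \<Rightarrow> 'a topology \<Rightarrow> 'a chart \<Rightarrow> bool" where
  "chart_on k l T = (\<lambda>(U, \<phi>).
     openin T U \<and> openin (product_space k l) (\<phi> ` U) \<and>
     homeomorphic_map (subtopology T U) (subtopology (product_space k l) (\<phi> ` U)) \<phi>)"

definition foliated_manifold ::
    "nat \<Rightarrow> nat \<Rightarrow> regularity \<Rightarrow> regularity \<Rightarrow> 'a foliated \<Rightarrow> bool" where
  "foliated_manifold k l r s W \<longleftrightarrow>
     Hausdorff_space (top_of W) \<and> second_countable (top_of W) \<and>
     (\<forall>c \<in> atlas W. chart_on k l (top_of W) c) \<and>
     (\<Union>(U, \<phi>) \<in> atlas W. U) = topspace (top_of W) \<and>
     (\<forall>(U, \<phi>) \<in> atlas W. \<forall>(V, \<psi>) \<in> atlas W.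
        foliated_form k l r s (\<phi> ` (U \<inter> V)) (\<psi> \<circ> inv_into U \<phi>))"

text \<open>
  The leaf topology is the finest topology for which the inclusions of the slices \<open>y = const\<close> of the
  charts are continuous; leaves are its connected components.
\<close>

definition leaf_open :: "nat \<Rightarrow> 'a foliated \<Rightarrow> 'a set \<Rightarrow> bool" where
  "leaf_open k W A \<longleftrightarrow> A \<subseteq> topspace (top_of W) \<and>
     (\<forall>(U, \<phi>) \<in> atlas W. \<forall>y. openin (Euclidean_space k) {x. (x, y) \<in> \<phi> ` (U \<inter> A)})"

definition leaf_topology :: "nat \<Rightarrow> 'a foliated \<Rightarrow> 'a topology" where
  "leaf_topology k W = topology (leaf_open k W)"

lemma openin_leaf_topology:
  assumes "foliated_manifold k l r s W"
  shows "openin (leaf_topology k W) A \<longleftrightarrow> leaf_open k W A"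
proof -
  have inj: "inj_on \<phi> U" if "(U, \<phi>) \<in> atlas W" for U \<phi>
  proof -
    from that assms have c: "chart_on k l (top_of W) (U, \<phi>)"
      by (auto simp: foliated_manifold_def)
    then have "topspace (subtopology (top_of W) U) = U"
      by (auto simp: chart_on_def dest: openin_subset)
    with c show ?thesis by (auto simp: chart_on_def homeomorphic_map_def)
  qed
  have "istopology (leaf_open k W)"
    unfolding istopology_def
  proof (intro conjI allI impI)
    fix A B assume AB: "leaf_open k W A" "leaf_open k W B"
    have "openin (Euclidean_space k) {x. (x, y) \<in> \<phi> ` (U \<inter> (A \<inter> B))}"
      if m: "(U, \<phi>) \<in> atlas W" for U \<phi> y
    proof -
      have "{x. (x, y) \<in> \<phi> ` (U \<inter> (A \<inter> B))} =
          {x. (x, y) \<in> \<phi> ` (U \<inter> A)} \<inter> {x. (x, y) \<in> \<phi> ` (U \<inter> B)}"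
        using inj[OF m] by (auto simp: inj_on_def image_iff) (metis Int_iff)
      then show ?thesis using AB m by (force simp: leaf_open_def intro!: openin_Int)
    qed
    with AB show "leaf_open k W (A \<inter> B)" by (auto simp: leaf_open_def)
  next
    fix \<K> assume K: "\<forall>K\<in>\<K>. leaf_open k W K"
    have "openin (Euclidean_space k) {x. (x, y) \<in> \<phi> ` (U \<inter> \<Union>\<K>)}"
      if m: "(U, \<phi>) \<in> atlas W" for U \<phi> y
    proof -
      have "{x. (x, y) \<in> \<phi> ` (U \<inter> \<Union>\<K>)} = (\<Union>K\<in>\<K>. {x. (x, y) \<in> \<phi> ` (U \<inter> K)})"
        by auto
      then show ?thesis using K m by (fastforce simp: leaf_open_def intro!: openin_Union)
    qed
    with K show "leaf_open k W (\<Union>\<K>)" by (auto simp: leaf_open_def)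
  qed
  then show ?thesis by (simp add: leaf_topology_def topology_inverse')
qed

definition leaves :: "nat \<Rightarrow> 'a foliated \<Rightarrow> 'a set set" where
  "leaves k W = connected_components_of (leaf_topology k W)"

text \<open>An open subset of a foliated manifold, with the induced structure.\<close>

definition restrict_foliated :: "'a foliated \<Rightarrow> 'a set \<Rightarrow> 'a foliated" where
  "restrict_foliated W U =
     \<lparr>top_of = subtopology (top_of W) U, atlas = (\<lambda>(V, \<phi>). (V \<inter> U, \<phi>)) ` atlas W\<rparr>"

definition regular_map ::
    "nat \<Rightarrow> nat \<Rightarrow> regularity \<Rightarrow> regularity \<Rightarrow> 'a foliated \<Rightarrow> 'b foliated \<Rightarrow> ('a \<Rightarrow> 'b) \<Rightarrow> bool" where
  "regular_map k l r s W W' f \<longleftrightarrow>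
     continuous_map (top_of W) (top_of W') f \<and>
     (\<forall>p \<in> topspace (top_of W). \<exists>(U, \<phi>) \<in> atlas W. \<exists>(V, \<psi>) \<in> atlas W'. \<exists>N.
        openin (top_of W) N \<and> p \<in> N \<and> N \<subseteq> U \<and> f ` N \<subseteq> V \<and>
        foliated_form k l r s (\<phi> ` N) (\<psi> \<circ> f \<circ> inv_into U \<phi>))"

definition foliated_diffeo ::
    "nat \<Rightarrow> nat \<Rightarrow> regularity \<Rightarrow> regularity \<Rightarrow> 'a foliated \<Rightarrow> 'b foliated \<Rightarrow> ('a \<Rightarrow> 'b) \<Rightarrow> bool" where
  "foliated_diffeo k l r s W W' f \<longleftrightarrow>
     (\<exists>g. homeomorphic_maps (top_of W) (top_of W') f g \<and>
        regular_map k l r s W W' f \<and> regular_map k l r s W' W g)"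


section \<open>Solenoids\<close>

text \<open>
  All foliated manifolds have their points in one arbitrary ambient type \<open>'a\<close>, so that the solenoids
  form a set.
\<close>

type_synonym 'a pre_sol = "'a set \<times> 'a foliated"
type_synonym 'a solenoid = "'a pre_sol set"

definition pre_solenoids :: "nat \<Rightarrow> nat \<Rightarrow> regularity \<Rightarrow> regularity \<Rightarrow> 'a pre_sol set" where
  "pre_solenoids k l r s = {(S, W). foliated_manifold k l r s W \<and>
     S \<noteq> {} \<and> compactin (top_of W) S \<and> (\<exists>\<L> \<subseteq> leaves k W. S = \<Union>\<L>)}"

definition pre_solenoid_equiv ::
    "nat \<Rightarrow> nat \<Rightarrow> regularity \<Rightarrow> regularity \<Rightarrow> ('a pre_sol \<times> 'a pre_sol) set" where
  "pre_solenoid_equiv k l r s = {((S1, W1), (S2, W2)).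
     (S1, W1) \<in> pre_solenoids k l r s \<and> (S2, W2) \<in> pre_solenoids k l r s \<and> S1 = S2 \<and>
     (\<exists>U1 U2 f. openin (top_of W1) U1 \<and> openin (top_of W2) U2 \<and> S1 \<subseteq> U1 \<and> S1 \<subseteq> U2 \<and>
        foliated_diffeo k l r s (restrict_foliated W1 U1) (restrict_foliated W2 U2) f \<and>
        (\<forall>p\<in>S1. f p = p))}"

definition solenoids :: "nat \<Rightarrow> nat \<Rightarrow> regularity \<Rightarrow> regularity \<Rightarrow> 'a solenoid set" where
  "solenoids k l r s = pre_solenoids k l r s // pre_solenoid_equiv k l r s"

text \<open>\<open>(S, W) \<in> \<sigma>\<close> means that the solenoid \<open>\<sigma>\<close> has underlying space \<open>S\<close> and that \<open>W\<close> defines its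
  solenoid structure.\<close>

definition leaves_in :: "nat \<Rightarrow> 'a set \<Rightarrow> 'a foliated \<Rightarrow> 'a set set" where
  "leaves_in k S W = {L \<in> leaves k W. L \<subseteq> S}"

definition sub_solenoid :: "nat \<Rightarrow> 'a solenoid \<Rightarrow> 'a solenoid \<Rightarrow> bool" where
  "sub_solenoid k \<sigma> \<sigma>' \<longleftrightarrow>
     (\<exists>S S' W. (S', W) \<in> \<sigma>' \<and> (\<exists>\<L> \<subseteq> leaves_in k S' W. S = \<Union>\<L>) \<and> (S, W) \<in> \<sigma>)"


section \<open>Inductive sets, for the decreasing direction\<close>

definition inductive_below :: "'b set \<Rightarrow> ('b \<Rightarrow> 'b \<Rightarrow> bool) \<Rightarrow> bool" where
  "inductive_below A le \<longleftrightarrow>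
     (\<forall>C. C \<subseteq> A \<and> C \<noteq> {} \<and> (\<forall>a\<in>C. \<forall>b\<in>C. le a b \<or> le b a) \<longrightarrow>
        (\<exists>m\<in>A. \<forall>c\<in>C. le m c))"

end

theory Submission
  imports Defs
begin

text \<open>
  Let \<open>C\<close> be a chain of solenoids and pick \<open>c0 \<in> C\<close>, the class of \<open>(S0, W0)\<close>.  The members of \<open>C\<close>
  below \<open>c0\<close> have underlying spaces that form a chain of non-empty compact subsets of \<open>S0\<close>.  Their
  intersection \<open>M\<close> is compact and non-empty, and it is a union of leaves of \<open>W0\<close> provided that each of
  them is; the class of \<open>(M, W0)\<close> is then the lower bound.

  The difficulty is that a comparison \<open>c \<le> c0\<close> or \<open>c0 \<le> c\<close> is witnessed by a foliated manifold \<open>W\<close>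
  depending on \<open>c\<close>, which is only known to agree with \<open>W0\<close> through a diffeomorphism of neighbourhoods
  of \<open>S0\<close> fixing \<open>S0\<close> pointwise.  So one has to know that \<open>W\<close> and \<open>W0\<close> have the same leaves inside
  \<open>S0\<close> (lemma \<open>pre_solenoid_equiv_subset\<close>).  A regular map has locally the form
  \<open>(x, y) \<mapsto> (X (x, y), Y y)\<close>, so it is continuous for the leaf topologies
  (lemma \<open>regular_map_leaf_continuous\<close>).  The diffeomorphism being the identity on \<open>S0\<close>, the leaf
  topologies of \<open>W\<close> and \<open>W0\<close> induce the same topology on \<open>S0\<close>, and leaves inside \<open>S0\<close> are the
  connected components of this induced topology.
\<close>

section \<open>Saturated sets\<close>

definition saturated :: "'a topology \<Rightarrow> 'a set \<Rightarrow> bool" where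
  "saturated T S \<longleftrightarrow> (\<exists>\<L> \<subseteq> connected_components_of T. S = \<Union>\<L>)"

lemma saturated_iff:
  "saturated T S \<longleftrightarrow> S \<subseteq> topspace T \<and> (\<forall>p\<in>S. connected_component_of_set T p \<subseteq> S)"
proof
  assume "saturated T S"
  then obtain \<L> where L: "\<L> \<subseteq> connected_components_of T" "S = \<Union>\<L>"
    by (auto simp: saturated_def)
  have "connected_component_of_set T p \<subseteq> S" if p: "p \<in> S" for p
  proof -
    from p L obtain K where K: "K \<in> \<L>" "p \<in> K" by auto
    with L obtain q where q: "K = connected_component_of_set T q"
      by (auto simp: connected_components_of_def)
    with K have "connected_component_of_set T p = K"
      using connected_component_of_equiv[of T q p] by (metis mem_Collect_eq)
    with K L show ?thesis by blast
  qed
  moreover have "S \<subseteq> topspace T"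
    using L Union_connected_components_of[of T] by blast
  ultimately show "S \<subseteq> topspace T \<and> (\<forall>p\<in>S. connected_component_of_set T p \<subseteq> S)" by blast
next
  assume S: "S \<subseteq> topspace T \<and> (\<forall>p\<in>S. connected_component_of_set T p \<subseteq> S)"
  have "S = \<Union>(connected_component_of_set T ` S)"
    using S connected_component_of_refl by fastforce
  moreover have "connected_component_of_set T ` S \<subseteq> connected_components_of T"
    using S by (auto simp: connected_components_of_def)
  ultimately show "saturated T S" by (auto simp: saturated_def)
qed

lemma saturated_Inter:
  assumes "\<S> \<noteq> {}" "\<And>S. S \<in> \<S> \<Longrightarrow> saturated T S"
  shows "saturated T (\<Inter>\<S>)"
  using assms by (fastforce simp: saturated_iff)

text \<open>
  Components that meet a saturated set \<open>S\<close> are connected in the topology induced on \<open>S\<close>; hence a map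
  that is continuous on \<open>S\<close> only, and the identity there, already sends them into components.
\<close>

lemma saturated_transfer:
  assumes S: "saturated T2 S" and sub: "S' \<subseteq> S"
    and cont: "continuous_map (subtopology T2 S) T1 id"
    and S': "saturated T1 S'"
  shows "saturated T2 S'"
  unfolding saturated_iff
proof (intro conjI ballI)
  show "S' \<subseteq> topspace T2" using S sub by (auto simp: saturated_iff)
next
  fix p assume p: "p \<in> S'"
  let ?K = "connected_component_of_set T2 p"
  have K: "connectedin T2 ?K" "?K \<subseteq> S"
    using S sub p by (auto simp: saturated_iff connectedin_connected_component_of)
  then have "connectedin (subtopology T2 S) ?K" by (simp add: connectedin_subtopology)
  then have "connectedin T1 (id ` ?K)" using cont connectedin_continuous_map_image by blast
  then have conn: "connectedin T1 ?K" by simp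
  have "p \<in> ?K"
    using S sub p by (auto simp: saturated_iff connected_component_of_refl)
  with conn have "?K \<subseteq> connected_component_of_set T1 p"
    by (metis connected_component_of_maximal)
  with S' p show "?K \<subseteq> S'" by (auto simp: saturated_iff)
qed


section \<open>The slice topology and the leaf topology\<close>

text \<open>
  The leaf topology of \<open>\<real>\<^sup>k \<times> \<real>\<^sup>l\<close>.  The transversal factor carries the discrete topology on all
  sequences rather than on \<open>\<real>\<^sup>l\<close>, so that every function of the transversal variable is continuous.
\<close>

definition slice_topology :: "nat \<Rightarrow> point topology" where
  "slice_topology k = prod_topology (Euclidean_space k) (discrete_topology UNIV)"

lemma openin_slice_topology:
  "openin (slice_topology k) E \<longleftrightarrow> (\<forall>y. openin (Euclidean_space k) {x. (x, y) \<in> E})"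
proof
  assume E: "openin (slice_topology k) E"
  show "\<forall>y. openin (Euclidean_space k) {x. (x, y) \<in> E}"
  proof
    fix y
    have "continuous_map (Euclidean_space k) (slice_topology k) (\<lambda>x. (x, y))"
      unfolding slice_topology_def by (intro continuous_map_paired[THEN iffD2]) auto
    from openin_continuous_map_preimage[OF this E]
    have "openin (Euclidean_space k) {x \<in> topspace (Euclidean_space k). (x, y) \<in> E}" .
    moreover have "{x \<in> topspace (Euclidean_space k). (x, y) \<in> E} = {x. (x, y) \<in> E}"
      using openin_subset[OF E] by (auto simp: slice_topology_def)
    ultimately show "openin (Euclidean_space k) {x. (x, y) \<in> E}" by simp
  qed
next
  assume E: "\<forall>y. openin (Euclidean_space k) {x. (x, y) \<in> E}"
  show "openin (slice_topology k) E"
    unfolding slice_topology_def openin_prod_topology_alt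
  proof (intro allI impI)
    fix x y assume "(x, y) \<in> E"
    with E show "\<exists>U V. openin (Euclidean_space k) U \<and> openin (discrete_topology UNIV) V \<and>
        x \<in> U \<and> y \<in> V \<and> U \<times> V \<subseteq> E"
      by (intro exI[of _ "{x. (x, y) \<in> E}"] exI[of _ "{y}"]) auto
  qed
qed

lemma leaf_open_iff:
  "leaf_open k W A \<longleftrightarrow> A \<subseteq> topspace (top_of W) \<and>
     (\<forall>(U, \<phi>) \<in> atlas W. openin (slice_topology k) (\<phi> ` (U \<inter> A)))"
  unfolding leaf_open_def openin_slice_topology by auto

lemma slice_topology_finer:
  assumes "openin (product_space k l) E"
  shows "openin (slice_topology k) E"
  using assms unfolding slice_topology_def openin_prod_topology_alt
  by (metis openin_discrete_topology subset_UNIV)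

text \<open>
  The first component of a foliated form is continuous for the finer topology, too, and the second
  is a function of the discrete variable.
\<close>

lemma foliated_form_slice_continuous:
  assumes form: "foliated_form k l r s D h"
    and cont: "continuous_map (subtopology (product_space k l) D) (product_space k l) h"
    and D: "openin (product_space k l) D"
  shows "continuous_map (subtopology (slice_topology k) D) (slice_topology k) h"
proof -
  from form obtain X Y where XY: "\<And>x y. (x, y) \<in> D \<Longrightarrow> h (x, y) = (X (x, y), Y y)"
    by (fastforce simp: foliated_form_def)
  have Dsub: "D \<subseteq> topspace (slice_topology k)"
    using slice_topology_finer[OF D] by (rule openin_subset)
  have id: "continuous_map (subtopology (slice_topology k) D)
      (subtopology (product_space k l) D) id"
    unfolding continuous_map
  proof (intro conjI allI impI)
    show "id ` topspace (subtopology (slice_topology k) D)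
        \<subseteq> topspace (subtopology (product_space k l) D)"
      using openin_subset[OF D] by auto
    fix E assume "openin (subtopology (product_space k l) D) E"
    with D have E: "openin (product_space k l) E" "E \<subseteq> D"
      by (auto simp: openin_open_subtopology)
    have "{x \<in> topspace (subtopology (slice_topology k) D). id x \<in> E} = E"
      using E Dsub by auto
    with slice_topology_finer[OF E(1)] E(2)
    show "openin (subtopology (slice_topology k) D)
        {x \<in> topspace (subtopology (slice_topology k) D). id x \<in> E}"
      by (metis openin_subset_topspace_eq openin_open_subtopology[OF slice_topology_finer[OF D]])
  qed
  have "continuous_map (subtopology (slice_topology k) D) (product_space k l) (h \<circ> id)"
    using continuous_map_compose[OF id cont] .
  then have "continuous_map (subtopology (slice_topology k) D) (Euclidean_space k) (fst \<circ> h)"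
    by (simp add: continuous_map_pairwise)
  moreover have "continuous_map (subtopology (slice_topology k) D) (discrete_topology UNIV) (snd \<circ> h)"
  proof (rule continuous_map_eq)
    have "continuous_map (subtopology (slice_topology k) D) (discrete_topology UNIV) snd"
      unfolding slice_topology_def
      by (intro continuous_map_from_subtopology continuous_map_snd)
    moreover have "continuous_map (discrete_topology UNIV) (discrete_topology UNIV) Y" by simp
    ultimately show "continuous_map (subtopology (slice_topology k) D) (discrete_topology UNIV) (Y \<circ> snd)"
      by (rule continuous_map_compose)
  qed (auto simp: XY)
  ultimately show ?thesis
    unfolding slice_topology_def continuous_map_pairwise by simp
qed

context
  fixes k l :: nat and T :: "'a topology" and U :: "'a set" and \<phi> :: "'a \<Rightarrow> point"
  assumes chart: "chart_on k l T (U, \<phi>)"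
begin

lemma chart_open: "openin T U" "openin (product_space k l) (\<phi> ` U)"
  using chart by (auto simp: chart_on_def)

lemma chart_inj_on: "inj_on \<phi> U"
proof -
  have "topspace (subtopology T U) = U"
    using openin_subset[OF chart_open(1)] by auto
  with chart show ?thesis
    by (auto simp: chart_on_def homeomorphic_map_def)
qed

lemma chart_continuous: "continuous_map (subtopology T U) (product_space k l) \<phi>"
  using chart
  by (auto simp: chart_on_def dest!: homeomorphic_imp_continuous_map
      intro: continuous_map_into_fulltopology)

lemma chart_inverse_continuous:
  "continuous_map (subtopology (product_space k l) (\<phi> ` U)) (subtopology T U) (inv_into U \<phi>)"
proof -
  from chart obtain g where g: "homeomorphic_maps (subtopology T U)
      (subtopology (product_space k l) (\<phi> ` U)) \<phi> g"
    by (auto simp: chart_on_def homeomorphic_map_maps)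
  have "g q = inv_into U \<phi> q" if "q \<in> \<phi> ` U" for q
    using that g chart_inj_on openin_subset[OF chart_open(1)]
    by (auto simp: homeomorphic_maps_def)
  then show ?thesis
    using g by (auto simp: homeomorphic_maps_def intro: continuous_map_eq)
qed

lemma chart_image_open:
  assumes "openin T A" "A \<subseteq> U"
  shows "openin (product_space k l) (\<phi> ` A)"
proof -
  have "openin (subtopology T U) A"
    using assms chart_open by (simp add: openin_open_subtopology)
  then have "openin (subtopology (product_space k l) (\<phi> ` U)) (\<phi> ` A)"
    using chart by (auto simp: chart_on_def dest!: homeomorphic_imp_open_map simp: open_map_def)
  then show ?thesis
    using chart_open by (simp add: openin_open_subtopology)
qed

end

context
  fixes k l :: nat and r s :: regularity and W :: "'a foliated"
  assumes man: "foliated_manifold k l r s W"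
begin

lemma atlas_chart_on: "(U, \<phi>) \<in> atlas W \<Longrightarrow> chart_on k l (top_of W) (U, \<phi>)"
  using man by (auto simp: foliated_manifold_def)

lemma leaf_open_if_open:
  assumes "openin (top_of W) A"
  shows "openin (leaf_topology k W) A"
  unfolding openin_leaf_topology[OF man] leaf_open_iff
proof (intro conjI ballI, unfold case_prod_unfold)
  fix c assume c: "c \<in> atlas W"
  then have ch: "chart_on k l (top_of W) (fst c, snd c)" using atlas_chart_on[of "fst c" "snd c"] by simp
  have "openin (product_space k l) (snd c ` (fst c \<inter> A))"
    using assms chart_open(1)[OF ch] by (intro chart_image_open[OF ch]) auto
  then show "openin (slice_topology k) (snd c ` (fst c \<inter> A))"
    by (rule slice_topology_finer)
qed (use assms openin_subset in auto)

lemma topspace_leaf_topology: "topspace (leaf_topology k W) = topspace (top_of W)"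
proof
  show "topspace (top_of W) \<subseteq> topspace (leaf_topology k W)"
    by (intro openin_subset leaf_open_if_open) simp
  have "leaf_open k W (topspace (leaf_topology k W))"
    using openin_leaf_topology[OF man] openin_topspace by blast
  then show "topspace (leaf_topology k W) \<subseteq> topspace (top_of W)"
    by (simp add: leaf_open_iff)
qed

text \<open>
  Charts are continuous from the leaf topology to the slice topology, because by compatibility of the
  atlas this can be checked in any other chart, where the transition map is a foliated form.
\<close>

lemma chart_leaf_open:
  assumes c: "(U, \<phi>) \<in> atlas W" and E: "openin (slice_topology k) E"
  shows "openin (leaf_topology k W) {p \<in> U. \<phi> p \<in> E}"
  unfolding openin_leaf_topology[OF man] leaf_open_iff
proof (intro conjI ballI)
  note ch = atlas_chart_on[OF c]
  show "{p \<in> U. \<phi> p \<in> E} \<subseteq> topspace (top_of W)"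
    using openin_subset[OF chart_open(1)[OF ch]] by auto
  fix d assume d: "d \<in> atlas W"
  obtain V \<psi> where d_eq: "d = (V, \<psi>)" by (cases d)
  from d have dV: "(V, \<psi>) \<in> atlas W" by (simp add: d_eq)
  note ch' = atlas_chart_on[OF dV]
  let ?D = "\<psi> ` (V \<inter> U)" and ?h = "\<phi> \<circ> inv_into V \<psi>"
  have D: "openin (product_space k l) ?D"
    using chart_open(1)[OF ch] chart_open(1)[OF ch'] by (intro chart_image_open[OF ch']) auto
  have inv: "inv_into V \<psi> (\<psi> p) = p" if "p \<in> V" for p
    using chart_inj_on[OF ch'] that by simp
  have form: "foliated_form k l r s ?D ?h"
    using man c dV by (fastforce simp: foliated_manifold_def)
  have "continuous_map (subtopology (product_space k l) ?D) (top_of W) (inv_into V \<psi>)"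
    by (rule continuous_map_from_subtopology_mono[OF
          continuous_map_into_fulltopology[OF chart_inverse_continuous[OF ch']]]) auto
  moreover have "inv_into V \<psi> ` ?D \<subseteq> U" using inv by auto
  ultimately have "continuous_map (subtopology (product_space k l) ?D)
      (subtopology (top_of W) U) (inv_into V \<psi>)"
    by (auto simp: continuous_map_in_subtopology inv)
  from continuous_map_compose[OF this chart_continuous[OF ch]]
  have "continuous_map (subtopology (slice_topology k) ?D) (slice_topology k) ?h"
    using foliated_form_slice_continuous[OF form _ D] by blast
  from openin_continuous_map_preimage[OF this E]
  have "openin (slice_topology k) {q \<in> topspace (subtopology (slice_topology k) ?D). ?h q \<in> E}"
    using openin_open_subtopology[OF slice_topology_finer[OF D]] by blast
  moreover have "{q \<in> topspace (subtopology (slice_topology k) ?D). ?h q \<in> E}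
      = \<psi> ` (V \<inter> {p \<in> U. \<phi> p \<in> E})"
  proof -
    have "topspace (subtopology (slice_topology k) ?D) = ?D"
      using openin_subset[OF slice_topology_finer[OF D]] by auto
    then show ?thesis using inv by force
  qed
  ultimately show "case d of (V, \<psi>) \<Rightarrow> openin (slice_topology k) (\<psi> ` (V \<inter> {p \<in> U. \<phi> p \<in> E}))"
    by (simp add: d_eq)
qed

end

text \<open>
  Near each point a regular map is a chart, followed by a foliated form, followed by the inverse of a
  chart.  The first two are continuous for the leaf and slice topologies by the lemmas above; the last
  one is because leaf-open sets have slice-open images under charts by definition.
\<close>

lemma regular_map_leaf_continuous:
  assumes man1: "foliated_manifold k l r s W1" and man2: "foliated_manifold k l r s W2"
    and U1: "openin (top_of W1) U1" and U2: "openin (top_of W2) U2"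
    and reg: "regular_map k l r s (restrict_foliated W1 U1) (restrict_foliated W2 U2) f"
  shows "continuous_map (subtopology (leaf_topology k W1) U1) (leaf_topology k W2) f"
  unfolding continuous_map
proof (intro conjI allI impI)
  have fcont: "continuous_map (subtopology (top_of W1) U1) (subtopology (top_of W2) U2) f"
    using reg by (simp add: regular_map_def restrict_foliated_def)
  have U1top: "U1 \<subseteq> topspace (top_of W1)" using U1 by (rule openin_subset)
  have top: "topspace (subtopology (leaf_topology k W1) U1) = U1"
    using U1top by (auto simp: topspace_leaf_topology[OF man1])
  show "f ` topspace (subtopology (leaf_topology k W1) U1) \<subseteq> topspace (leaf_topology k W2)"
    using continuous_map_image_subset_topspace[OF fcont] U1top
    unfolding top topspace_leaf_topology[OF man2] by auto
  fix A assume A: "openin (leaf_topology k W2) A"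
  let ?B = "{p \<in> U1. f p \<in> A}"
  have "\<exists>G. openin (leaf_topology k W1) G \<and> p \<in> G \<and> G \<subseteq> ?B" if p: "p \<in> ?B" for p
  proof -
    have "\<forall>p \<in> U1. \<exists>c \<in> atlas W1. \<exists>d \<in> atlas W2. \<exists>N.
        openin (subtopology (top_of W1) U1) N \<and> p \<in> N \<and> N \<subseteq> fst c \<inter> U1 \<and> f ` N \<subseteq> fst d \<inter> U2 \<and>
        foliated_form k l r s (snd c ` N) (snd d \<circ> f \<circ> inv_into (fst c \<inter> U1) (snd c))"
      using reg U1top
      by (simp add: regular_map_def restrict_foliated_def case_prod_unfold Int_absorb1)
    with p obtain c d N where
      "c \<in> atlas W1" "d \<in> atlas W2" "openin (subtopology (top_of W1) U1) N" "p \<in> N"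
      "N \<subseteq> fst c \<inter> U1" "f ` N \<subseteq> fst d \<inter> U2"
      "foliated_form k l r s (snd c ` N) (snd d \<circ> f \<circ> inv_into (fst c \<inter> U1) (snd c))"
      by blast
    moreover obtain U \<phi> V \<psi> where "c = (U, \<phi>)" "d = (V, \<psi>)" by (cases c; cases d)
    ultimately have
      c: "(U, \<phi>) \<in> atlas W1" and c': "(V, \<psi>) \<in> atlas W2" and
      N: "openin (top_of W1) N" "p \<in> N" "N \<subseteq> U \<inter> U1" "f ` N \<subseteq> V \<inter> U2" and
      form: "foliated_form k l r s (\<phi> ` N) (\<psi> \<circ> f \<circ> inv_into (U \<inter> U1) \<phi>)"
      by (simp_all add: openin_open_subtopology[OF U1])
    note ch = atlas_chart_on[OF man1 c] and ch' = atlas_chart_on[OF man2 c']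
    let ?D = "\<phi> ` N" and ?i = "inv_into (U \<inter> U1) \<phi>"
    have D: "openin (product_space k l) ?D"
      using N by (intro chart_image_open[OF ch]) auto
    have inj: "inj_on \<phi> (U \<inter> U1)"
      using chart_inj_on[OF ch] by (rule inj_on_subset) auto
    have inv: "?i (\<phi> q) = q" if "q \<in> N" for q
      using inj that N(3) by (auto intro: inv_into_f_f)
    have "continuous_map (subtopology (product_space k l) ?D) (top_of W1) ?i"
    proof (rule continuous_map_eq)
      show "continuous_map (subtopology (product_space k l) ?D) (top_of W1) (inv_into U \<phi>)"
        using continuous_map_into_fulltopology[OF chart_inverse_continuous[OF ch]]
          continuous_map_from_subtopology_mono N(3) by (metis image_mono le_inf_iff)
    qed (use inv chart_inj_on[OF ch] N(3) in auto)
    then have "continuous_map (subtopology (product_space k l) ?D) (subtopology (top_of W1) N) ?i"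
      by (auto simp: continuous_map_in_subtopology inv)
    moreover have "continuous_map (subtopology (top_of W1) N) (subtopology (top_of W2) V) f"
    proof -
      have "continuous_map (subtopology (top_of W1) N) (top_of W2) f"
        using continuous_map_into_fulltopology[OF fcont] continuous_map_from_subtopology_mono N(3)
        by (metis le_inf_iff)
      with N(4) show ?thesis by (auto simp: continuous_map_in_subtopology)
    qed
    ultimately have "continuous_map (subtopology (product_space k l) ?D) (product_space k l)
        (\<psi> \<circ> f \<circ> ?i)"
      using chart_continuous[OF ch'] by (metis continuous_map_compose comp_assoc)
    from foliated_form_slice_continuous[OF form this D]
    have hcont: "continuous_map (subtopology (slice_topology k) ?D) (slice_topology k) (\<psi> \<circ> f \<circ> ?i)" .
    have "openin (slice_topology k) (\<psi> ` (V \<inter> A))"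
      using A c' by (auto simp: openin_leaf_topology[OF man2] leaf_open_iff)
    from openin_continuous_map_preimage[OF hcont this]
    have E: "openin (slice_topology k)
        {q \<in> topspace (subtopology (slice_topology k) ?D). (\<psi> \<circ> f \<circ> ?i) q \<in> \<psi> ` (V \<inter> A)}"
      (is "openin _ ?E")
      using openin_open_subtopology[OF slice_topology_finer[OF D]] by blast
    have mem: "\<phi> q \<in> ?E \<longleftrightarrow> f q \<in> A" if q: "q \<in> N" for q
    proof -
      have "\<phi> q \<in> topspace (subtopology (slice_topology k) ?D)"
        using q openin_subset[OF slice_topology_finer[OF D]] by auto
      moreover have "f q \<in> V" using q N(4) by auto
      ultimately show ?thesis
        using inv[OF q] chart_inj_on[OF ch'] by (auto simp: inj_on_def)
    qed
    have "openin (leaf_topology k W1) (N \<inter> {q \<in> U. \<phi> q \<in> ?E})"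
      using chart_leaf_open[OF man1 c E] leaf_open_if_open[OF man1 N(1)] by (rule openin_Int[rotated])
    moreover have "N \<inter> {q \<in> U. \<phi> q \<in> ?E} = N \<inter> {q \<in> U. f q \<in> A}"
      using mem by blast
    ultimately have "openin (leaf_topology k W1) (N \<inter> {q \<in> U. f q \<in> A})" by simp
    with N p show ?thesis by (intro exI[of _ "N \<inter> {q \<in> U. f q \<in> A}"]) auto
  qed
  then have "openin (leaf_topology k W1) ?B" by (subst openin_subopen) blast
  then show "openin (subtopology (leaf_topology k W1) U1)
      {p \<in> topspace (subtopology (leaf_topology k W1) U1). f p \<in> A}"
    unfolding top using openin_open_subtopology[OF leaf_open_if_open[OF man1 U1]] by auto
qed


section \<open>Equivalent pre-solenoids have the same saturated subsets\<close>

lemma pre_solenoids_iff: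
  "(S, W) \<in> pre_solenoids k l r s \<longleftrightarrow>
     foliated_manifold k l r s W \<and> S \<noteq> {} \<and> compactin (top_of W) S \<and> saturated (leaf_topology k W) S"
  by (simp add: pre_solenoids_def saturated_def leaves_def)

lemma pre_solenoid_equiv_sym:
  assumes "(A, B) \<in> pre_solenoid_equiv k l r s"
  shows "(B, A) \<in> pre_solenoid_equiv k l r s"
proof -
  from assms obtain S W1 W2 U1 U2 f where eq: "A = (S, W1)" "B = (S, W2)"
    and pre: "(S, W1) \<in> pre_solenoids k l r s" "(S, W2) \<in> pre_solenoids k l r s"
    and U: "openin (top_of W1) U1" "openin (top_of W2) U2" "S \<subseteq> U1" "S \<subseteq> U2"
    and f: "foliated_diffeo k l r s (restrict_foliated W1 U1) (restrict_foliated W2 U2) f"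
    and fid: "\<forall>p\<in>S. f p = p"
    by (auto simp: pre_solenoid_equiv_def)
  from f obtain g where
    g: "homeomorphic_maps (top_of (restrict_foliated W1 U1)) (top_of (restrict_foliated W2 U2)) f g"
    and reg: "regular_map k l r s (restrict_foliated W1 U1) (restrict_foliated W2 U2) f"
      "regular_map k l r s (restrict_foliated W2 U2) (restrict_foliated W1 U1) g"
    by (auto simp: foliated_diffeo_def)
  have "g p = p" if "p \<in> S" for p
  proof -
    have "p \<in> topspace (top_of (restrict_foliated W1 U1))"
      using that U openin_subset by (fastforce simp: restrict_foliated_def)
    with g have "g (f p) = p" by (auto simp: homeomorphic_maps_def)
    with fid that show ?thesis by simp
  qed
  moreover have "foliated_diffeo k l r s (restrict_foliated W2 U2) (restrict_foliated W1 U1) g"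
    using g[THEN homeomorphic_maps_sym[THEN iffD1]] reg unfolding foliated_diffeo_def by blast
  ultimately have "\<exists>U2 U1 g. openin (top_of W2) U2 \<and> openin (top_of W1) U1 \<and> S \<subseteq> U2 \<and> S \<subseteq> U1 \<and>
      foliated_diffeo k l r s (restrict_foliated W2 U2) (restrict_foliated W1 U1) g \<and> (\<forall>p\<in>S. g p = p)"
    using U by blast
  with eq pre show ?thesis by (simp add: pre_solenoid_equiv_def)
qed

text \<open>
  An equivalence over \<open>S\<close> restricts to every sub-solenoid of \<open>(S, W1)\<close>.  The point is that \<open>S'\<close> is
  saturated for \<open>W2\<close>: the inverse diffeomorphism is continuous for the leaf topologies and is the
  identity on \<open>S\<close>, so it carries each leaf of \<open>W2\<close> inside \<open>S\<close> into a leaf of \<open>W1\<close>.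
\<close>

lemma pre_solenoid_equiv_subset:
  assumes eqv: "((S, W1), (S, W2)) \<in> pre_solenoid_equiv k l r s"
    and S': "(S', W1) \<in> pre_solenoids k l r s" and sub: "S' \<subseteq> S"
  shows "((S', W1), (S', W2)) \<in> pre_solenoid_equiv k l r s"
proof -
  from eqv obtain U1 U2 f where pre: "(S, W1) \<in> pre_solenoids k l r s" "(S, W2) \<in> pre_solenoids k l r s"
    and U: "openin (top_of W1) U1" "openin (top_of W2) U2" "S \<subseteq> U1" "S \<subseteq> U2"
    and f: "foliated_diffeo k l r s (restrict_foliated W1 U1) (restrict_foliated W2 U2) f"
    and fid: "\<forall>p\<in>S. f p = p"
    by (auto simp: pre_solenoid_equiv_def)
  from pre_solenoid_equiv_sym[OF eqv] obtain V1 V2 g where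
    V: "openin (top_of W1) V1" "openin (top_of W2) V2" "S \<subseteq> V1" "S \<subseteq> V2"
    and g: "foliated_diffeo k l r s (restrict_foliated W2 V2) (restrict_foliated W1 V1) g"
    and gid: "\<forall>p\<in>S. g p = p"
    by (auto simp: pre_solenoid_equiv_def)
  have man: "foliated_manifold k l r s W1" "foliated_manifold k l r s W2"
    using pre by (auto simp: pre_solenoids_iff)
  have "compactin (top_of W2) S'"
  proof -
    have "continuous_map (subtopology (top_of W1) U1) (subtopology (top_of W2) U2) f"
      using f by (auto simp: foliated_diffeo_def regular_map_def restrict_foliated_def)
    moreover have "compactin (subtopology (top_of W1) U1) S'"
      using S' sub U by (auto simp: pre_solenoids_iff compactin_subtopology)
    ultimately have "compactin (subtopology (top_of W2) U2) (f ` S')"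
      by (rule image_compactin[rotated])
    moreover have "f ` S' = S'" using fid sub by force
    ultimately show ?thesis by (simp add: compactin_subtopology)
  qed
  moreover have "saturated (leaf_topology k W2) S'"
  proof (rule saturated_transfer)
    show "saturated (leaf_topology k W2) S" "saturated (leaf_topology k W1) S'"
      using pre S' by (auto simp: pre_solenoids_iff)
    have "continuous_map (subtopology (leaf_topology k W2) V2) (leaf_topology k W1) g"
      using g by (intro regular_map_leaf_continuous[OF man(2,1) V(2,1)]) (auto simp: foliated_diffeo_def)
    then have "continuous_map (subtopology (leaf_topology k W2) S) (leaf_topology k W1) g"
      using continuous_map_from_subtopology_mono V(4) by blast
    then show "continuous_map (subtopology (leaf_topology k W2) S) (leaf_topology k W1) id"
      by (rule continuous_map_eq) (use gid in auto)
  qed (rule sub)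
  ultimately have "(S', W2) \<in> pre_solenoids k l r s"
    using S' man by (simp add: pre_solenoids_iff)
  with S' sub U f fid show ?thesis
    unfolding pre_solenoid_equiv_def by blast
qed


section \<open>Lower bounds of chains\<close>

lemma compact_chain_Inter_nonempty:
  assumes haus: "Hausdorff_space T" and ne: "\<S> \<noteq> {}"
    and comp: "\<And>S. S \<in> \<S> \<Longrightarrow> compactin T S \<and> S \<noteq> {}"
    and chain: "\<And>A B. A \<in> \<S> \<Longrightarrow> B \<in> \<S> \<Longrightarrow> A \<subseteq> B \<or> B \<subseteq> A"
  shows "compactin T (\<Inter>\<S>)" "\<Inter>\<S> \<noteq> {}"
proof -
  have cl: "closedin T S" if "S \<in> \<S>" for S
    using haus comp[OF that] by (simp add: compactin_imp_closedin)
  from ne obtain S0 where S0: "S0 \<in> \<S>" by blast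
  show "compactin T (\<Inter>\<S>)"
    using comp[OF S0] S0 cl by (blast intro: closed_compactin_Inter)
  have fin: "S0 \<inter> \<Inter>\<F> \<noteq> {}" if "finite \<F>" "\<F> \<subseteq> \<S>" for \<F>
  proof -
    have "\<exists>A\<in>\<S>. A \<subseteq> S0 \<inter> \<Inter>\<F>"
      using that
    proof (induction \<F> rule: finite_induct)
      case empty
      then show ?case using S0 by auto
    next
      case (insert B \<F>)
      then obtain A where A: "A \<in> \<S>" "A \<subseteq> S0 \<inter> \<Inter>\<F>" by auto
      have B: "B \<in> \<S>" using insert.prems by simp
      from chain[OF A(1) B] show ?case
      proof
        assume "A \<subseteq> B"
        with A(2) have "A \<subseteq> S0 \<inter> \<Inter>(insert B \<F>)" by simp
        with A(1) show ?thesis by (rule bexI[rotated])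
      next
        assume "B \<subseteq> A"
        then have "B \<subseteq> S0 \<inter> \<Inter>\<F>" using A(2) by (rule subset_trans)
        then have "B \<subseteq> S0 \<inter> \<Inter>(insert B \<F>)" by simp
        with B show ?thesis by (rule bexI[rotated])
      qed
    qed
    then obtain A where "A \<in> \<S>" "A \<subseteq> S0 \<inter> \<Inter>\<F>" by blast
    with comp[of A] show ?thesis by (metis subset_empty)
  qed
  have "S0 \<inter> \<Inter>\<S> \<noteq> {}"
    using comp[OF S0, THEN conjunct1, unfolded compactin_fip, THEN conjunct2, rule_format, of \<S>]
      cl fin by simp
  then show "\<Inter>\<S> \<noteq> {}" by blast
qed

lemma sub_solenoidE:
  assumes "sub_solenoid k \<sigma> \<sigma>'"
  obtains S S' W where "(S', W) \<in> \<sigma>'" "(S, W) \<in> \<sigma>" "S \<subseteq> S'"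
  using assms unfolding sub_solenoid_def leaves_in_def by blast

theorem theorem2p13:
  fixes k l :: nat and r s :: regularity
  assumes "s \<le> r"
  shows "inductive_below (solenoids k l r s :: 'a solenoid set) (sub_solenoid k)"
  unfolding inductive_below_def
proof (intro allI impI, elim conjE)
  fix C :: "'a solenoid set"
  assume CA: "C \<subseteq> solenoids k l r s" and C: "C \<noteq> {}"
    and total: "\<forall>a\<in>C. \<forall>b\<in>C. sub_solenoid k a b \<or> sub_solenoid k b a"
  let ?R = "pre_solenoid_equiv k l r s :: ('a pre_sol \<times> 'a pre_sol) set"
  define P where "P = (pre_solenoids k l r s :: 'a pre_sol set)"
  have repr: "\<exists>S W. c = ?R `` {(S, W)} \<and> (S, W) \<in> P" if "c \<in> C" for c
    using that CA by (fastforce simp: solenoids_def quotient_def P_def)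
  have same: "S = S'" if "c \<in> C" "(S, W) \<in> c" "(S', W') \<in> c" for c S S' W W'
    using repr[OF that(1)] that(2,3) by (auto simp: pre_solenoid_equiv_def)
  have inP: "(S, W) \<in> P" if "c \<in> C" "(S, W) \<in> c" for c S W
    using repr[OF that(1)] that(2) by (auto simp: pre_solenoid_equiv_def P_def)
  from C obtain c0 where c0: "c0 \<in> C" by blast
  from repr[OF c0] obtain S0 W0 where c0_eq: "c0 = ?R `` {(S0, W0)}" and "(S0, W0) \<in> P" by blast
  then have man0: "foliated_manifold k l r s W0" by (simp add: P_def pre_solenoids_iff)
  define \<S> where "\<S> = {S. \<exists>c\<in>C. \<exists>W. sub_solenoid k c c0 \<and> (S, W) \<in> c}"
  \<comment> \<open>Before they can be intersected, the spaces below \<open>c0\<close>, known to be compact and saturated for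
    manifolds \<open>W\<close> varying with \<open>c\<close>, must all be moved into the one manifold \<open>W0\<close>.\<close>
  have SW0: "(S, W0) \<in> P \<and> S \<subseteq> S0" if "S \<in> \<S>" for S
  proof -
    from that obtain c V where c: "c \<in> C" "sub_solenoid k c c0" "(S, V) \<in> c"
      by (auto simp: \<S>_def)
    obtain S1 S2 W where W: "(S2, W) \<in> c0" "(S1, W) \<in> c" "S1 \<subseteq> S2"
      using c(2) by (rule sub_solenoidE)
    have "S1 = S" using same[OF c(1) W(2) c(3)] .
    moreover have eqv: "((S0, W0), (S0, W)) \<in> ?R" "S2 = S0"
      using W(1) by (auto simp: c0_eq pre_solenoid_equiv_def)
    ultimately have "((S, W), (S, W0)) \<in> ?R"
      using pre_solenoid_equiv_subset[OF pre_solenoid_equiv_sym[OF eqv(1)], of S] W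
        inP[OF c(1) W(2)] by (simp add: P_def)
    with \<open>S1 = S\<close> eqv(2) W(3) show ?thesis by (auto simp: pre_solenoid_equiv_def P_def)
  qed
  have sub_imp: "S \<subseteq> S'" if le: "sub_solenoid k c d" "c \<in> C" "d \<in> C" "(S, V) \<in> c" "(S', V') \<in> d"
    for c d S S' V V'
  proof -
    obtain S1 S2 W where W: "(S2, W) \<in> d" "(S1, W) \<in> c" "S1 \<subseteq> S2"
      using le(1) by (rule sub_solenoidE)
    with same[OF le(2) W(2) le(4)] same[OF le(3) W(1) le(5)] show ?thesis by simp
  qed
  have chain: "A \<subseteq> B \<or> B \<subseteq> A" if "A \<in> \<S>" "B \<in> \<S>" for A B
  proof -
    from that obtain c V d V' where cd: "c \<in> C" "(A, V) \<in> c" "d \<in> C" "(B, V') \<in> d"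
      by (auto simp: \<S>_def)
    with total have "sub_solenoid k c d \<or> sub_solenoid k d c" by simp
    then show ?thesis
      using sub_imp[OF _ cd(1,3,2,4)] sub_imp[OF _ cd(3,1,4,2)] by (elim disjE) simp_all
  qed
  have ne: "\<S> \<noteq> {}"
  proof -
    have refl: "sub_solenoid k c0 c0" using total c0 by blast
    then obtain S W where "(S, W) \<in> c0" by (rule sub_solenoidE)
    with c0 refl have "S \<in> \<S>" by (auto simp: \<S>_def)
    then show ?thesis by blast
  qed
  let ?M = "\<Inter>\<S>"
  have "Hausdorff_space (top_of W0)" using man0 by (simp add: foliated_manifold_def)
  then have "compactin (top_of W0) ?M" "?M \<noteq> {}"
    using compact_chain_Inter_nonempty[OF _ ne, of "top_of W0"] SW0 chain
    by (auto simp: P_def pre_solenoids_iff)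
  moreover have "saturated (leaf_topology k W0) ?M"
    using ne SW0 by (intro saturated_Inter) (auto simp: P_def pre_solenoids_iff)
  ultimately have M: "(?M, W0) \<in> P"
    using man0 by (simp add: P_def pre_solenoids_iff)
  have MS0: "?M \<subseteq> S0" using ne SW0 by blast
  let ?m = "?R `` {(?M, W0)}"
  \<comment> \<open>A foliated manifold defining both \<open>c0\<close> and a member \<open>c\<close> of the chain defines \<open>?m\<close>, too, and
    so witnesses \<open>?m \<le> c\<close>; a comparison of \<open>c\<close> with \<open>c0\<close> provides one, whichever is smaller.\<close>
  have below: "sub_solenoid k ?m c" if W: "(S0, W) \<in> c0" "(S, W) \<in> c" "?M \<subseteq> S" for c S W
  proof -
    have "((S0, W0), (S0, W)) \<in> ?R" using W(1) by (simp add: c0_eq)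
    from pre_solenoid_equiv_subset[OF this _ MS0] M
    have eqv: "((?M, W0), (?M, W)) \<in> ?R" by (simp add: P_def)
    then have "(?M, W) \<in> pre_solenoids k l r s" by (auto simp: pre_solenoid_equiv_def)
    then obtain \<L> where L: "\<L> \<subseteq> leaves k W" "?M = \<Union>\<L>"
      by (auto simp: pre_solenoids_def)
    then have "\<L> \<subseteq> leaves_in k S W"
      using W(3) by (auto simp: leaves_in_def)
    with L(2) eqv W(2) show ?thesis
      unfolding sub_solenoid_def by (intro exI[of _ ?M] exI[of _ S] exI[of _ W] conjI exI[of _ \<L>]) simp_all
  qed
  show "\<exists>m\<in>solenoids k l r s. \<forall>c\<in>C. sub_solenoid k m c"
  proof (intro bexI ballI)
    show "?m \<in> solenoids k l r s"
      using M by (auto simp: solenoids_def P_def intro: quotientI)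
    fix c assume c: "c \<in> C"
    from total c c0 consider "sub_solenoid k c c0" | "sub_solenoid k c0 c" by blast
    then show "sub_solenoid k ?m c"
    proof cases
      case 1
      obtain S1 S2 W where W: "(S2, W) \<in> c0" "(S1, W) \<in> c"
        using 1 by (rule sub_solenoidE)
      have "S2 = S0" using W(1) by (auto simp: c0_eq pre_solenoid_equiv_def)
      moreover have "S1 \<in> \<S>" using 1 c W(2) by (auto simp: \<S>_def)
      ultimately show ?thesis using W by (intro below) auto
    next
      case 2
      obtain S1 S2 W where W: "(S2, W) \<in> c" "(S1, W) \<in> c0" "S1 \<subseteq> S2"
        using 2 by (rule sub_solenoidE)
      have "S1 = S0" using W(2) by (auto simp: c0_eq pre_solenoid_equiv_def)
      with W MS0 show ?thesis by (intro below[OF _ W(1)]) auto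
    qed
  qed
qed

end
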